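(* Let $N\ge2$ and $m_1,\dots,m_N\in\{+1,-1\}$, and let $N^+$ and $N^-$ be the numbers of indices $j$ with $m_j=+1$ and $m_j=-1$, respectively. If the system $$\dot{\mathbf x}_j(t)=2m_j\sum_{k=1,k\ne j}^N m_k\frac{\mathbf x_j(t)-\mathbf x_k(t)}{|\mathbf x_j(t)-\mathbf x_k(t)|^2},\qquad 1\le j\le N,$$ admits an equilibrium solution $\mathbf X(t)\equiv\mathbf X^0\in\mathbb R_*^{2\times N}$, then $N\ge4$ is the square of an integer, namely $N=(N^+-N^-)^2$, and $$1\le N^+=\tfrac12\big(N\pm\sqrt N\big)<N,\qquad 1\le N^-=N-N^+<N$$ (for one of the two choices of sign).
   Context: $\mathbb R_*^{2\times N}:=\{(\mathbf x_1,\dots,\mathbf x_N)\in\mathbb R^{2\times N} : \mathbf x_j\neq\mathbf x_l\in\mathbb R^2 \text{ for } 1\le j<l\le N\}$. *)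

theory Defs
  imports "HOL-Analysis.Analysis"
begin

text \<open>
  The finite index type \<open>'n\<close> plays the role of the index set \<open>{1, \<dots>, N}\<close>, so that \<open>N = CARD('n)\<close>;
  a configuration of \<open>N\<close> points of the plane is an element of \<open>(real ^ 2) ^ 'n\<close>.
\<close>

definition config_space :: "((real ^ 2) ^ 'n) set" where
  "config_space = {X. \<forall>j l. j \<noteq> l \<longrightarrow> X $ j \<noteq> X $ l}"

definition vortex_rhs :: "('n::finite \<Rightarrow> int) \<Rightarrow> (real ^ 2) ^ 'n \<Rightarrow> 'n \<Rightarrow> real ^ 2" where
  "vortex_rhs m X j =
     (2 * real_of_int (m j)) *\<^sub>R
       (\<Sum>k\<in>UNIV - {j}. real_of_int (m k) *\<^sub>R ((X $ j - X $ k) /\<^sub>R ((norm (X $ j - X $ k))\<^sup>2)))"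

text \<open>Solutions are considered for times \<open>t \<ge> 0\<close>, with a one-sided derivative at \<open>t = 0\<close>.\<close>

definition vortex_solution :: "('n::finite \<Rightarrow> int) \<Rightarrow> (real \<Rightarrow> (real ^ 2) ^ 'n) \<Rightarrow> bool" where
  "vortex_solution m X \<longleftrightarrow>
     (\<forall>t\<ge>0. X t \<in> config_space \<and>
        (\<forall>j. ((\<lambda>s. X s $ j) has_vector_derivative vortex_rhs m (X t) j) (at t within {0..})))"

definition num_pos :: "('n::finite \<Rightarrow> int) \<Rightarrow> nat" where
  "num_pos m = card {j. m j = 1}"

definition num_neg :: "('n::finite \<Rightarrow> int) \<Rightarrow> nat" where
  "num_neg m = card {j. m j = - 1}"

end

theory Submission
  imports Defs
begin

text \<open>
  At an equilibrium the pairing of the \<open>j\<close>-th equation with \<open>x\<^sub>j\<close>, summed over \<open>j\<close>, gives a double sum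
  over pairs \<open>(j, k)\<close>. Exchanging \<open>j\<close> and \<open>k\<close> and averaging replaces \<open>x\<^sub>j\<close> by
  \<open>(x\<^sub>j - x\<^sub>k) / 2\<close>, and the distances cancel: what remains is that the sum of \<open>m\<^sub>j m\<^sub>k\<close> over
  \<open>j \<noteq> k\<close> vanishes, that is \<open>(N\<^sup>+ - N\<^sup>-)\<^sup>2 = N\<close> because \<open>m\<^sub>j\<^sup>2 = 1\<close>.
\<close>

text \<open>A constant curve has derivative zero, and the one-sided derivative at time
  \<open>0\<close> is unique because \<open>0\<close> is a limit point of
  \<open>{0..}\<close>.\<close>

lemma vortex_rhs_equilibrium:
  assumes "vortex_solution m (\<lambda>t. X)"
  shows "vortex_rhs m X j = 0"
proof -
  have "((\<lambda>s. X $ j) has_vector_derivative vortex_rhs m X j) (at 0 within {0..})"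
    using assms by (simp add: vortex_solution_def)
  moreover have "at (0::real) within {0..} \<noteq> bot"
    by (simp add: at_within_Ici_at_right)
  ultimately show ?thesis
    using vector_derivative_unique_within has_vector_derivative_const by blast
qed

lemma sum_mutual_zero_of_equilibrium:
  fixes m :: "'n::finite \<Rightarrow> int"
  assumes X: "X \<in> config_space" and nz: "\<And>j. m j \<noteq> 0" and eq: "\<And>j. vortex_rhs m X j = 0"
  shows "(\<Sum>j\<in>UNIV. \<Sum>k\<in>UNIV - {j}. m j * m k) = 0"
proof -
  \<comment> \<open>The terms of the paired equations, without the factor 2. They vanish for
    \<open>k = j\<close>, so the sums may run over all pairs, a range symmetric under exchanging the
    indices.\<close>
  define f where "f j k = real_of_int (m j * m k) *
    (((X $ j - X $ k) /\<^sub>R (norm (X $ j - X $ k))\<^sup>2) \<bullet> X $ j)" for j k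
  have diagonal: "f j j = 0" for j
    by (simp add: f_def)
  have row: "(\<Sum>k\<in>UNIV. f j k) = 0" for j
  proof -
    \<comment> \<open>The prefactor \<open>2 * m j\<close> cancels since \<open>m j\<close> is
      nonzero; multiplying by \<open>m j\<close> again afterwards makes the weight symmetric in
      \<open>j\<close> and \<open>k\<close>.\<close>
    have "(\<Sum>k\<in>UNIV - {j}. real_of_int (m k) *\<^sub>R ((X $ j - X $ k) /\<^sub>R (norm (X $ j - X $ k))\<^sup>2)) = 0"
      using eq[of j] nz[of j] by (simp add: vortex_rhs_def)
    from arg_cong[OF this, of "\<lambda>v. real_of_int (m j) * (v \<bullet> X $ j)"]
    have "(\<Sum>k\<in>UNIV - {j}. f j k) = 0"
      by (simp add: f_def inner_sum_left sum_distrib_left mult.assoc)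
    then show ?thesis
      by (simp add: sum.remove[of UNIV j] diagonal)
  qed
  \<comment> \<open>The difference \<open>d\<close> changes sign under the exchange, so the two
    inner products combine to \<open>d \<bullet> d\<close>, which the squared distance
    cancels.\<close>
  have pair: "f j k + f k j = real_of_int (if k = j then 0 else m j * m k)" for j k
  proof (cases "k = j")
    case False
    define d where "d = X $ j - X $ k"
    have d: "d \<noteq> 0"
      using X False by (auto simp: config_space_def d_def)
    have kj: "X $ k - X $ j = - d"
      by (simp add: d_def)
    have "f j k + f k j = real_of_int (m j * m k) * ((d \<bullet> X $ j - d \<bullet> X $ k) / (norm d)\<^sup>2)"
      unfolding f_def kj d_def[symmetric]
      by (simp add: diff_divide_distrib algebra_simps divide_inverse)
    also have "(d \<bullet> X $ j - d \<bullet> X $ k) / (norm d)\<^sup>2 = 1"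
      using d by (simp add: inner_diff_right[symmetric] d_def[symmetric] power2_norm_eq_inner)
    finally show ?thesis
      using False by simp
  qed (simp add: diagonal)
  have "real_of_int (\<Sum>j\<in>UNIV. \<Sum>k\<in>UNIV. if k = j then 0 else m j * m k)
      = (\<Sum>j\<in>UNIV. \<Sum>k\<in>UNIV. f j k + f k j)"
    by (simp only: pair of_int_sum)
  also have "\<dots> = (\<Sum>j\<in>UNIV. \<Sum>k\<in>UNIV. f j k) + (\<Sum>k\<in>UNIV. \<Sum>j\<in>UNIV. f k j)"
    by (simp only: sum.distrib sum.swap[of "\<lambda>j k. f k j"])
  also have "\<dots> = 0"
    by (simp add: row)
  finally have "(\<Sum>j\<in>UNIV. \<Sum>k\<in>UNIV. if k = j then 0 else m j * m k) = 0"
    by (simp only: of_int_eq_0_iff)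
  moreover have "(\<Sum>k\<in>UNIV. if k = j then 0 else m j * m k) = (\<Sum>k\<in>UNIV - {j}. m j * m k)" for j
    by (simp add: sum.remove[of UNIV j])
  ultimately show ?thesis
    by simp
qed

text \<open>Expanding the square, the off-diagonal products sum to zero and only the diagonal is
  left.\<close>

lemma power2_sum_eq_sum_squares:
  fixes a :: "'n::finite \<Rightarrow> 'a::comm_ring_1"
  assumes "(\<Sum>j\<in>UNIV. \<Sum>k\<in>UNIV - {j}. a j * a k) = 0"
  shows "(\<Sum>j\<in>UNIV. a j)\<^sup>2 = (\<Sum>j\<in>UNIV. (a j)\<^sup>2)"
proof -
  have "(\<Sum>j\<in>UNIV. a j)\<^sup>2 = (\<Sum>j\<in>UNIV. \<Sum>k\<in>UNIV. a j * a k)"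
    by (simp add: power2_eq_square sum_product)
  also have "\<dots> = (\<Sum>j\<in>UNIV. (a j)\<^sup>2 + (\<Sum>k\<in>UNIV - {j}. a j * a k))"
  proof (rule sum.cong[OF refl])
    show "(\<Sum>k\<in>UNIV. a j * a k) = (a j)\<^sup>2 + (\<Sum>k\<in>UNIV - {j}. a j * a k)" for j
      by (simp add: sum.remove[of UNIV j] power2_eq_square)
  qed
  finally show ?thesis
    using assms by (simp add: sum.distrib)
qed

lemma
  fixes m :: "'n::finite \<Rightarrow> int"
  assumes "\<forall>j. m j \<in> {1, - 1}"
  shows card_eq_num_pos_plus_num_neg: "CARD('n) = num_pos m + num_neg m"
    and sum_eq_num_pos_minus_num_neg: "(\<Sum>j\<in>UNIV. m j) = int (num_pos m) - int (num_neg m)"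
proof -
  have split: "UNIV = {j. m j = 1} \<union> {j. m j = - 1}"
    using assms by auto
  have disjoint: "{j. m j = 1} \<inter> {j. m j = - 1} = {}"
    by auto
  show "CARD('n) = num_pos m + num_neg m"
    unfolding num_pos_def num_neg_def split
    by (rule card_Un_disjoint) (auto simp: disjoint)
  have "(\<Sum>j\<in>UNIV. m j) = (\<Sum>j\<in>{j. m j = 1}. m j) + (\<Sum>j\<in>{j. m j = - 1}. m j)"
    unfolding split by (rule sum.union_disjoint) (auto simp: disjoint)
  then show "(\<Sum>j\<in>UNIV. m j) = int (num_pos m) - int (num_neg m)"
    by (simp add: num_pos_def num_neg_def)
qed

theorem proposition2p2:
  fixes m :: "'n::finite \<Rightarrow> int" and N :: nat
  assumes "N = CARD('n)" and "N \<ge> 2"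
    and "\<forall>j. m j \<in> {1, - 1}"
    and "\<exists>X0 \<in> config_space. vortex_solution m (\<lambda>t. X0)"
  shows "N \<ge> 4 \<and> (\<exists>k::int. int N = k\<^sup>2)
    \<and> int N = (int (num_pos m) - int (num_neg m))\<^sup>2
    \<and> (real (num_pos m) = (real N + sqrt (real N)) / 2
        \<or> real (num_pos m) = (real N - sqrt (real N)) / 2)
    \<and> 1 \<le> num_pos m \<and> num_pos m < N
    \<and> int (num_neg m) = int N - int (num_pos m)
    \<and> 1 \<le> num_neg m \<and> num_neg m < N"
proof -
  obtain X where X: "X \<in> config_space" "vortex_solution m (\<lambda>t. X)"
    using assms(4) by blast
  have nz: "m j \<noteq> 0" and sq: "(m j)\<^sup>2 = 1" for j
    using assms(3)[rule_format, of j] by auto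
  define p q where "p = num_pos m" and "q = num_neg m"
  have N: "N = p + q"
    using card_eq_num_pos_plus_num_neg[OF assms(3)] by (simp add: assms(1) p_def q_def)
  have "(\<Sum>j\<in>UNIV. \<Sum>k\<in>UNIV - {j}. m j * m k) = 0"
    using X nz by (intro sum_mutual_zero_of_equilibrium vortex_rhs_equilibrium)
  from power2_sum_eq_sum_squares[OF this] have square: "int N = (int p - int q)\<^sup>2"
    by (simp add: sum_eq_num_pos_minus_num_neg[OF assms(3)] sq assms(1) p_def q_def)
  \<comment> \<open>This is the square root of \<open>N\<close> as a nonnegative integer;
    \<open>N \<ge> 2\<close> excludes the values 0 and 1.\<close>
  define d where "d = \<bar>int p - int q\<bar>"
  have d: "int N = d\<^sup>2"
    using square by (simp add: d_def)
  then have "d \<noteq> 0" "d \<noteq> 1"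
    using assms(2) by auto
  moreover have "d \<ge> 0"
    by (simp add: d_def)
  ultimately have "2 \<le> d"
    by linarith
  then have "2\<^sup>2 \<le> d\<^sup>2"
    by (rule power_mono) simp
  then have N4: "N \<ge> 4"
    using d by simp
  \<comment> \<open>If all signs agreed, \<open>p\<close> or \<open>q\<close> would be zero and
    \<open>d\<close> would equal \<open>p + q = N\<close>; but \<open>d < d * d\<close> once
    \<open>d \<ge> 2\<close>.\<close>
  have "d < int N"
    using d \<open>2 \<le> d\<close> by (simp add: power2_eq_square)
  then have "p \<noteq> 0" "q \<noteq> 0"
    using N by (auto simp: d_def)
  moreover have "sqrt (real N) = \<bar>real p - real q\<bar>"
  proof -
    have "real N = (real p - real q)\<^sup>2"
      using arg_cong[OF square, of real_of_int] by simp
    then show ?thesis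
      by simp
  qed
  \<comment> \<open>Add \<open>p + q = N\<close> to \<open>p - q\<close>, which is plus or minus the
    root; the sign depends on which of \<open>p\<close> and \<open>q\<close> is larger.\<close>
  then have "real p = (real N + sqrt (real N)) / 2 \<or> real p = (real N - sqrt (real N)) / 2"
    using N by (auto simp: abs_if)
  ultimately show ?thesis
    using N N4 square unfolding p_def[symmetric] q_def[symmetric] by auto
qed

end
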